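(* Let $\mathcal{N}=(P,T,F)$ be a Petri net and let $\langle M_0,Q\rangle$ be a slicing criterion for $\mathcal{N}$. Then the net $\mathcal{N}'$ computed (returned) by the maximal contributing slice algorithm (MaxSlice) on input $\mathcal{N}$, $\langle M_0,Q\rangle$ is a maximal slice of $\mathcal{N}$ with respect to $\langle M_0,Q\rangle$.
   Context: **Petri nets.** A Petri net is $\mathcal{N}=(P,T,F)$ with $P$ (places) and $T$ (transitions) finite sets, $P\cap T=\emptyset$, $P\cup T\neq\emptyset$, and $F$ a flow relation assigning a weight in $\mathbb{N}\setminus\{0\}$ to each arc, the arcs being a subset of $(P\times T)\cup(T\times P)$ (weight $0$ = no arc). For a node $x$, ${}^\bullet x$ and $x^\bullet$ are the sets of nodes $y$ having an arc $(y,x)$, resp. $(x,y)$; for a set $X$ of nodes ${}^\bullet X=\bigcup_{x\in X}{}^\bullet x$, $X^\bullet=\bigcup_{x\in X}x^\bullet$. A marking is $M:P\to\mathbb{N}$. A transition $t$ is enabled in $M$ ($M\xrightarrow{t}$) iff $M(p)\ge F(p,t)$ for all $p\in{}^\bullet t$; firing it removes $F(p,t)$ tokens from each $p\in{}^\bullet t$ and adds $F(t,p')$ tokens to each $p'\in t^\bullet$ ($M\xrightarrow{t}M'$). A firing sequence is $\sigma=t_1\ldots t_n$ with $M_0\xrightarrow{t_1}M_1\cdots\xrightarrow{t_n}M_n$. **Subnets.** $\mathcal{N}'=(P',T',F')$ is a subnet of $\mathcal{N}$ if it is a Petri net with $P'\subseteq P$, $T'\subseteq T$ and $F'=F|_{(P',T')}$,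 the restriction of $F$ to $(P'\times T')\cup(T'\times P')$. **Slicing criterion.** A pair $\langle M_0,Q\rangle$ with $M_0$ an (initial) marking of $\mathcal{N}$ and $Q\subseteq P$. **Increasing firing sequence** of $\mathcal{N}$ w.r.t. $\langle M_0,Q\rangle$: a firing sequence $\sigma=t_1\ldots t_n$, $M_0\xrightarrow{t_1}\cdots\xrightarrow{t_{n-1}}M_{n-1}\xrightarrow{t_n}M_n$, with $M_{n-1}(p)<M_n(p)$ for some $p\in Q$. For a subnet $\mathcal{N}'=(P',T',F')$, an increasing firing sequence in $\mathcal{N}'$ w.r.t. $\langle M_0,Q\rangle$ is one of $\mathcal{N}'$ started from $M_0|_{P'}$, with $p\in Q\cap P'$. **Subsequence.** $\sigma'$ is a subsequence of a firing sequence $\sigma$ w.r.t. a set of transitions $S$ if $\sigma'$ consists of all transition firings in $\sigma$ of transitions in $S$, in the same order. When $\sigma'$ is a firing sequence of a subnet $(P',T',F')$, "subsequence" is meant w.r.t. $S=T'$. **Slice.** $\mathcal{N}'=(P',T',F')$ is a slice of $\mathcal{N}$ w.r.t. $\langle M_0,Q\rangle$ if (1) it is a subnet of $\mathcal{N}$ such that for every $t\in T'$, every $p\in{}^\bullet t$ (preset in $\mathcal{N}$) lies in $P'$; and (2) there is an increasing firing sequence $\sigma'$ in $\mathcal{N}'$ w.r.t. $\langle M_0,Q\rangle$ that is a subsequence of some increasing firing sequence $\sigma$ in $\mathcal{N}$ w.r.t. $\langle M_0,Q\rangle$. **Maximal slice.** A slice $\mathcal{N}'$ of $\mathcal{N}$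 w.r.t. $\langle M_0,Q\rangle$ such that for each increasing firing sequence $\sigma$ in $\mathcal{N}$ w.r.t. $\langle M_0,Q\rangle$ there is an increasing firing sequence $\sigma'$ in $\mathcal{N}'$ w.r.t. $\langle M_0,Q\rangle$ that is a subsequence of $\sigma$. **Algorithm MaxSlice.** Input: $\mathcal{N}=(P,T,F)$, $\langle M_0,Q\rangle$. Presets and postsets are taken in $\mathcal{N}$. Step 1 (backward slice). $(P_b,T_b)=\mathsf{b\_slice}(Q,\emptyset)$, $F_b=F|_{(P_b,T_b)}$, where $\mathsf{b\_slice}(\emptyset,W_{done})=(\emptyset,\emptyset)$ and, for $W\ne\emptyset$, choosing some $p\in W$ and putting $T_{in}={}^\bullet p$, $W'_{done}=W_{done}\cup\{p\}$, $$\mathsf{b\_slice}(W,W_{done})=(\{p\}\cup{}^\bullet T_{in},\,T_{in})\oplus\mathsf{b\_slice}((W\cup{}^\bullet T_{in})\setminus W'_{done},\,W'_{done}),$$ with $(A,B)\oplus(A',B')=(A\cup A',B\cup B')$. Step 2 (forward slice). $(P_f,T_f)=\mathsf{f\_slice}(\{p\in P_b: M_0(p)>0\},\emptyset,\{t\in T_b: M_0\xrightarrow{t}\})$, $F_f=F_b|_{(P_f,T_f)}$, $\mathcal{N}_f=(P_f,T_f,F_f)$, where $\mathsf{f\_slice}(W,R,\emptyset)=(W,R)$ and, for $V\neq\emptyset$, $\mathsf{f\_slice}(W,R,V)=\mathsf{f\_slice}(W\cup V^\bullet,R\cup V,V')$ with $V'=\{t\in T_b\setminus(R\cup V): {}^\bullet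 t\subseteq W\cup V^\bullet\}$. Step 3. If $\mathcal{N}_f=(\emptyset,\emptyset,\emptyset)$, return "no slice exists". Otherwise return $\mathcal{N}'=(P',T',F|_{(P',T')})$, where $P'$ (resp. $T'$) consists of the $p\in P_f$ (resp. $t\in T_f$) for which there is a directed path in $\mathcal{N}_f$ (possibly of length $0$) to some place of $Q$.
   Formalization: The claim is proved assuming that some slice of the net w.r.t. the criterion exists; without this it fails, e.g. for a single marked place in Q with no transitions, where MaxSlice returns a net although no slice exists. *)

theory Defs
  imports Main
begin

text \<open>
  Nodes live in one type; \<open>flow N x y\<close> is the weight of the arc from \<open>x\<close> to \<open>y\<close>,
  and weight 0 means that there is no arc.
\<close>

record 'a net =
  places :: "'a set"
  transitions :: "'a set"
  flow :: "'a \<Rightarrow> 'a \<Rightarrow> nat"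

definition petri_net :: "'a net \<Rightarrow> bool" where
  "petri_net N \<longleftrightarrow>
     finite (places N) \<and> finite (transitions N) \<and>
     places N \<inter> transitions N = {} \<and> places N \<union> transitions N \<noteq> {} \<and>
     (\<forall>x y. flow N x y \<noteq> 0 \<longrightarrow>
        x \<in> places N \<and> y \<in> transitions N \<or> x \<in> transitions N \<and> y \<in> places N)"

definition pre :: "'a net \<Rightarrow> 'a \<Rightarrow> 'a set" where
  "pre N x = {y. flow N y x \<noteq> 0}"

definition post :: "'a net \<Rightarrow> 'a \<Rightarrow> 'a set" where
  "post N x = {y. flow N x y \<noteq> 0}"

definition pre_set :: "'a net \<Rightarrow> 'a set \<Rightarrow> 'a set" where
  "pre_set N X = (\<Union>x\<in>X. pre N x)"

definition post_set :: "'a net \<Rightarrow> 'a set \<Rightarrow> 'a set" where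
  "post_set N X = (\<Union>x\<in>X. post N x)"

text \<open>
  A marking is a function on the places only; it is represented by the function on all
  nodes that extends it by 0.
\<close>

type_synonym 'a marking = "'a \<Rightarrow> nat"

definition marking :: "'a net \<Rightarrow> 'a marking \<Rightarrow> bool" where
  "marking N M \<longleftrightarrow> (\<forall>x. x \<notin> places N \<longrightarrow> M x = 0)"

definition restrict_marking :: "'a marking \<Rightarrow> 'a set \<Rightarrow> 'a marking" where
  "restrict_marking M P' = (\<lambda>p. if p \<in> P' then M p else 0)"

definition enabled :: "'a net \<Rightarrow> 'a marking \<Rightarrow> 'a \<Rightarrow> bool" where
  "enabled N M t \<longleftrightarrow> t \<in> transitions N \<and> (\<forall>p\<in>pre N t. flow N p t \<le> M p)"

text \<open>The subtraction on natural numbers never truncates here, since \<open>t\<close> is enabled.\<close>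

definition fires :: "'a net \<Rightarrow> 'a marking \<Rightarrow> 'a \<Rightarrow> 'a marking \<Rightarrow> bool" where
  "fires N M t M' \<longleftrightarrow> enabled N M t \<and> M' = (\<lambda>p. M p - flow N p t + flow N t p)"

inductive firing_seq :: "'a net \<Rightarrow> 'a marking \<Rightarrow> 'a list \<Rightarrow> 'a marking \<Rightarrow> bool"
  for N :: "'a net" where
  Nil: "firing_seq N M [] M"
| Cons: "fires N M t M' \<Longrightarrow> firing_seq N M' \<sigma> M'' \<Longrightarrow> firing_seq N M (t # \<sigma>) M''"

definition restrict_flow ::
    "('a \<Rightarrow> 'a \<Rightarrow> nat) \<Rightarrow> 'a set \<Rightarrow> 'a set \<Rightarrow> 'a \<Rightarrow> 'a \<Rightarrow> nat" where
  "restrict_flow F P' T' =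
     (\<lambda>x y. if x \<in> P' \<and> y \<in> T' \<or> x \<in> T' \<and> y \<in> P' then F x y else 0)"

definition subnet :: "'a net \<Rightarrow> 'a net \<Rightarrow> bool" where
  "subnet N' N \<longleftrightarrow>
     petri_net N' \<and> places N' \<subseteq> places N \<and> transitions N' \<subseteq> transitions N \<and>
     flow N' = restrict_flow (flow N) (places N') (transitions N')"

definition slicing_criterion :: "'a net \<Rightarrow> 'a marking \<Rightarrow> 'a set \<Rightarrow> bool" where
  "slicing_criterion N M0 Q \<longleftrightarrow> marking N M0 \<and> Q \<subseteq> places N"

definition increasing :: "'a net \<Rightarrow> 'a marking \<Rightarrow> 'a set \<Rightarrow> 'a list \<Rightarrow> bool" where
  "increasing N M0 Q \<sigma> \<longleftrightarrow>
     (\<exists>\<rho> t M M'. \<sigma> = \<rho> @ [t] \<and> firing_seq N M0 \<rho> M \<and> fires N M t M' \<and>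
        (\<exists>p\<in>Q. M p < M' p))"

definition increasing_in_subnet :: "'a net \<Rightarrow> 'a marking \<Rightarrow> 'a set \<Rightarrow> 'a list \<Rightarrow> bool" where
  "increasing_in_subnet N' M0 Q \<sigma> \<longleftrightarrow>
     increasing N' (restrict_marking M0 (places N')) (Q \<inter> places N') \<sigma>"

definition subsequence_wrt :: "'a set \<Rightarrow> 'a list \<Rightarrow> 'a list \<Rightarrow> bool" where
  "subsequence_wrt S \<sigma>' \<sigma> \<longleftrightarrow> \<sigma>' = filter (\<lambda>t. t \<in> S) \<sigma>"

definition slice :: "'a net \<Rightarrow> 'a net \<Rightarrow> 'a marking \<Rightarrow> 'a set \<Rightarrow> bool" where
  "slice N' N M0 Q \<longleftrightarrow>
     subnet N' N \<and> (\<forall>t\<in>transitions N'. \<forall>p\<in>pre N t. p \<in> places N') \<and>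
     (\<exists>\<sigma>' \<sigma>. increasing_in_subnet N' M0 Q \<sigma>' \<and> increasing N M0 Q \<sigma> \<and>
        subsequence_wrt (transitions N') \<sigma>' \<sigma>)"

definition maximal_slice :: "'a net \<Rightarrow> 'a net \<Rightarrow> 'a marking \<Rightarrow> 'a set \<Rightarrow> bool" where
  "maximal_slice N' N M0 Q \<longleftrightarrow>
     slice N' N M0 Q \<and>
     (\<forall>\<sigma>. increasing N M0 Q \<sigma> \<longrightarrow>
        (\<exists>\<sigma>'. increasing_in_subnet N' M0 Q \<sigma>' \<and>
              subsequence_wrt (transitions N') \<sigma>' \<sigma>))"

text \<open>
  The algorithm is given by its input/output relation: the last argument is a possible
  result of a terminating run.  The backward slice selects an arbitrary place of the work
  set in each call, so that a priori there may be several results.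
\<close>

inductive b_slice :: "'a net \<Rightarrow> 'a set \<Rightarrow> 'a set \<Rightarrow> 'a set \<times> 'a set \<Rightarrow> bool"
  for N :: "'a net" where
  empty: "b_slice N {} Wdone ({}, {})"
| step: "p \<in> W \<Longrightarrow> Tin = pre N p \<Longrightarrow> Wdone' = Wdone \<union> {p} \<Longrightarrow>
    b_slice N ((W \<union> pre_set N Tin) - Wdone') Wdone' (A, B) \<Longrightarrow>
    b_slice N W Wdone (({p} \<union> pre_set N Tin) \<union> A, Tin \<union> B)"

inductive f_slice ::
    "'a net \<Rightarrow> 'a set \<Rightarrow> 'a set \<Rightarrow> 'a set \<Rightarrow> 'a set \<Rightarrow> 'a set \<times> 'a set \<Rightarrow> bool"
  for N :: "'a net" and Tb :: "'a set" where
  empty: "f_slice N Tb W R {} (W, R)"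
| step: "V \<noteq> {} \<Longrightarrow>
    V' = {t \<in> Tb - (R \<union> V). pre N t \<subseteq> W \<union> post_set N V} \<Longrightarrow>
    f_slice N Tb (W \<union> post_set N V) (R \<union> V) V' res \<Longrightarrow>
    f_slice N Tb W R V res"

definition restrict_net :: "'a net \<Rightarrow> 'a set \<Rightarrow> 'a set \<Rightarrow> 'a net" where
  "restrict_net N P' T' =
     \<lparr>places = P', transitions = T', flow = restrict_flow (flow N) P' T'\<rparr>"

definition empty_net :: "'a net" where
  "empty_net = \<lparr>places = {}, transitions = {}, flow = (\<lambda>x y. 0)\<rparr>"

definition reaches :: "'a net \<Rightarrow> 'a set \<Rightarrow> 'a \<Rightarrow> bool" where
  "reaches N Q x \<longleftrightarrow> (\<exists>q\<in>Q. (x, q) \<in> {(u, v). flow N u v \<noteq> 0}\<^sup>*)"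

text \<open>
  The result \<open>None\<close> stands for the answer ``no slice exists''.  Since postsets are taken
  in \<open>N\<close>, the set \<open>Pf\<close> need not be contained in \<open>Pb\<close>; the arcs of \<open>Nf\<close>
  are those of the backward slice \<open>Nb\<close> nevertheless.
\<close>

definition MaxSlice :: "'a net \<Rightarrow> 'a marking \<Rightarrow> 'a set \<Rightarrow> 'a net option \<Rightarrow> bool" where
  "MaxSlice N M0 Q res \<longleftrightarrow>
     (\<exists>Pb Tb Pf Tf Nb Nf.
        b_slice N Q {} (Pb, Tb) \<and> Nb = restrict_net N Pb Tb \<and>
        f_slice N Tb {p \<in> Pb. M0 p > 0} {} {t \<in> Tb. enabled N M0 t} (Pf, Tf) \<and>
        Nf = restrict_net Nb Pf Tf \<and>
        res = (if Nf = empty_net then None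
               else Some (restrict_net N {p \<in> Pf. reaches Nf Q p} {t \<in> Tf. reaches Nf Q t})))"

text \<open>
  \<open>MaxSlice\<close> may return a net although no slice exists at all: a single place that is
  marked and has no transitions around it.  Hence its result is a slice only under the
  assumption that some slice exists.
\<close>

lemma MaxSlice_without_slice:
  fixes q :: 'a
  defines "N \<equiv> \<lparr>places = {q}, transitions = {}, flow = (\<lambda>x y. 0)\<rparr>"
    and "M0 \<equiv> (\<lambda>x. if x = q then 1 else 0)"
  shows "petri_net N" "slicing_criterion N M0 {q}"
    and "\<exists>N'. MaxSlice N M0 {q} (Some N')"
    and "\<nexists>S. slice S N M0 {q}"
proof -
  show "petri_net N" "slicing_criterion N M0 {q}"
    by (auto simp: N_def M0_def petri_net_def slicing_criterion_def marking_def)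
  have [simp]: "pre N q = {}" "pre_set N {} = {}"
    by (simp_all add: N_def pre_def pre_set_def)
  have b: "b_slice N {q} {} ({q}, {})"
    using b_slice.step[of q "{q}" "{}" N "{q}" "{}" "{}" "{}"] b_slice.empty[of N "{q}"]
    by simp
  have f: "f_slice N {} {p \<in> {q}. M0 p > 0} {} {t \<in> {}. enabled N M0 t} ({q}, {})"
  proof -
    have "{p \<in> {q}. M0 p > 0} = {q}"
      by (auto simp: M0_def)
    then show ?thesis
      using f_slice.empty[of N "{}" "{q}" "{}"] by simp
  qed
  have "restrict_net (restrict_net N {q} {}) {q} {} \<noteq> empty_net"
    by (simp add: restrict_net_def empty_net_def)
  with b f have "MaxSlice N M0 {q} (Some (restrict_net N
      {p \<in> {q}. reaches (restrict_net (restrict_net N {q} {}) {q} {}) {q} p}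
      {t \<in> {}. reaches (restrict_net (restrict_net N {q} {}) {q} {}) {q} t}))"
    unfolding MaxSlice_def
    by (intro exI[of _ "{q}"] exI[of _ "{}"] exI[of _ "restrict_net N {q} {}"]
        exI[of _ "restrict_net (restrict_net N {q} {}) {q} {}"] conjI) simp_all
  then show "\<exists>N'. MaxSlice N M0 {q} (Some N')" ..
  show "\<nexists>S. slice S N M0 {q}"
  proof
    assume "\<exists>S. slice S N M0 {q}"
    then obtain \<sigma> where "increasing N M0 {q} \<sigma>"
      unfolding slice_def by blast
    then show False
      unfolding increasing_def fires_def enabled_def by (auto simp: N_def)
  qed
qed

end

theory Submission
  imports Defs
begin

text \<open>
  The backward slice is closed under presets, so only its own transitions put tokens on its
  places; hence every transition of the backward slice that fires in \<open>N\<close> is found by the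
  forward slice.  Consequently no transition outside the result ever puts tokens on a place
  of the result.  Dropping these firings can therefore only leave more tokens on the places
  of the result, and the remaining firings stay enabled there.
\<close>

section \<open>The backward slice\<close>

lemma petri_net_arcs:
  assumes "petri_net N"
  shows "p \<in> places N \<Longrightarrow> pre N p \<subseteq> transitions N"
    and "t \<in> transitions N \<Longrightarrow> pre N t \<subseteq> places N"
    and "t \<in> transitions N \<Longrightarrow> post N t \<subseteq> places N"
  using assms unfolding petri_net_def pre_def post_def by blast+

lemma pre_pre_subset_places:
  assumes "petri_net N" and "p \<in> places N"
  shows "pre_set N (pre N p) \<subseteq> places N"
  using petri_net_arcs[OF assms(1)] assms(2) unfolding pre_set_def by blast

text \<open>Each call moves the chosen place into \<open>D\<close>. Disjointness of \<open>W\<close>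
  and \<open>D\<close> makes that place new, so the finite set \<open>places N - D\<close> shrinks
  strictly.\<close>

lemma b_slice_exists:
  assumes "petri_net N" and "W \<subseteq> places N" and "W \<inter> D = {}"
  shows "\<exists>A B. b_slice N W D (A, B)"
  using assms(2,3)
proof (induction "card (places N - D)" arbitrary: W D rule: less_induct)
  case less
  show ?case
  proof (cases "W = {}")
    case True
    then show ?thesis
      using b_slice.empty by blast
  next
    case False
    then obtain p where p: "p \<in> W"
      by blast
    let ?D = "D \<union> {p}"
    let ?W = "(W \<union> pre_set N (pre N p)) - ?D"
    have "places N - ?D \<subset> places N - D"
      using p less.prems by blast
    then have "card (places N - ?D) < card (places N - D)"
      using assms(1) by (intro psubset_card_mono) (auto simp: petri_net_def)
    moreover have "pre_set N (pre N p) \<subseteq> places N"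
      using p less.prems(1) pre_pre_subset_places[OF assms(1)] by blast
    then have "?W \<subseteq> places N"
      using less.prems(1) by blast
    moreover have "?W \<inter> ?D = {}"
      by blast
    ultimately obtain A B where "b_slice N ?W ?D (A, B)"
      using less.hyps by blast
    then show ?thesis
      using b_slice.step[OF p refl refl] by blast
  qed
qed

text \<open>\<open>D\<close> holds the places treated by earlier calls. Their presets were collected
  there, which is why such places are excepted; at \<open>D = {}\<close> the exception
  disappears.\<close>

lemma b_slice_closed:
  assumes "b_slice N W D (A, B)"
  shows "W \<subseteq> A \<union> D" and "\<forall>p\<in>A. p \<in> D \<or> pre N p \<subseteq> B" and "\<forall>t\<in>B. pre N t \<subseteq> A"
  using assms
proof (induction W D "(A, B)" arbitrary: A B rule: b_slice.induct)
  case (step p W Tin D' D A B)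
  {
    case 1
    show ?case
      using step by blast
  next
    case 2
    show ?case
      using step by blast
  next
    case 3
    show ?case
      using step by (fastforce simp: pre_set_def)
  }
qed simp_all

lemma b_slice_subset:
  assumes "b_slice N W D (A, B)" and "petri_net N" and "W \<subseteq> places N"
  shows "A \<subseteq> places N \<and> B \<subseteq> transitions N"
  using assms(1,3)
proof (induction W D "(A, B)" arbitrary: A B rule: b_slice.induct)
  case (step p W Tin D' D A B)
  have "Tin \<subseteq> transitions N" "pre_set N Tin \<subseteq> places N"
    using step(1,2,6) petri_net_arcs(1)[OF assms(2)] pre_pre_subset_places[OF assms(2)] by blast+
  with step show ?case
    by blast
qed simp

section \<open>The forward slice\<close>

lemma f_slice_exists:
  assumes "finite Tb" and "V \<subseteq> Tb - R"
  shows "\<exists>A B. f_slice N Tb W R V (A, B)"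
  using assms(2)
proof (induction "card (Tb - R)" arbitrary: W R V rule: less_induct)
  case less
  show ?case
  proof (cases "V = {}")
    case True
    then show ?thesis
      using f_slice.empty by blast
  next
    case False
    let ?V = "{t \<in> Tb - (R \<union> V). pre N t \<subseteq> W \<union> post_set N V}"
    have "Tb - (R \<union> V) \<subset> Tb - R"
      using False less.prems by blast
    then have "card (Tb - (R \<union> V)) < card (Tb - R)"
      using assms(1) by (intro psubset_card_mono) auto
    moreover have "?V \<subseteq> Tb - (R \<union> V)"
      by blast
    ultimately obtain A B where "f_slice N Tb (W \<union> post_set N V) (R \<union> V) ?V (A, B)"
      using less.hyps by blast
    then show ?thesis
      using f_slice.step[OF False refl] by blast
  qed
qed

lemma f_slice_transitions_subset:
  assumes "f_slice N Tb W R V (A, B)"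
  shows "R \<union> V \<subseteq> B"
  using assms by (induction W R V "(A, B)" rule: f_slice.induct) auto

lemma f_slice_places:
  assumes "f_slice N Tb W R V (A, B)" and "post_set N R \<subseteq> W"
  shows "A = W \<union> post_set N B"
  using assms
proof (induction W R V "(A, B)" rule: f_slice.induct)
  case (step V V' R W)
  then have "V \<subseteq> B"
    using f_slice_transitions_subset by blast
  moreover have "A = W \<union> post_set N V \<union> post_set N B"
    using step by (auto simp: post_set_def)
  ultimately show ?case
    by (auto simp: post_set_def)
qed (auto simp: post_set_def)

lemma f_slice_transitions:
  assumes "f_slice N Tb W R V (A, B)" and "R \<union> V \<subseteq> Tb"
  shows "B \<subseteq> Tb"
  using assms by (induction W R V "(A, B)" rule: f_slice.induct) auto

lemma f_slice_pre:
  assumes "f_slice N Tb W R V (A, B)" and "\<forall>t\<in>R \<union> V. pre N t \<subseteq> W"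
  shows "\<forall>t\<in>B. pre N t \<subseteq> A"
  using assms by (induction W R V "(A, B)" rule: f_slice.induct) auto

text \<open>From the second call on, \<open>V\<close> contains every remaining candidate, so an
  empty \<open>V\<close> means closure. The initial \<open>V\<close> is chosen differently by the
  algorithm (by enabledness), so closure is assumed if it is already empty.\<close>

lemma f_slice_closed:
  assumes "f_slice N Tb W R V (A, B)" and "V = {} \<Longrightarrow> \<forall>t\<in>Tb. pre N t \<subseteq> W \<longrightarrow> t \<in> R"
  shows "\<forall>t\<in>Tb. pre N t \<subseteq> A \<longrightarrow> t \<in> B"
  using assms by (induction W R V "(A, B)" rule: f_slice.induct) auto

section \<open>Firing sequences\<close>

lemma enabled_imp_marked:
  assumes "enabled N M t" and "p \<in> pre N t"
  shows "0 < M p"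
proof -
  have "flow N p t \<le> M p" "flow N p t \<noteq> 0"
    using assms by (simp_all add: enabled_def pre_def)
  then show ?thesis
    by simp
qed

lemma firing_seq_snoc:
  assumes "firing_seq N M \<rho> M'" and "fires N M' t M''"
  shows "firing_seq N M (\<rho> @ [t]) M''"
  using assms by (induction rule: firing_seq.induct) (auto intro: firing_seq.intros)

lemma increasing_firing_seq:
  assumes "increasing N M0 Q \<sigma>"
  shows "\<exists>M. firing_seq N M0 \<sigma> M"
proof -
  obtain \<rho> t M M' where "\<sigma> = \<rho> @ [t]" "firing_seq N M0 \<rho> M" "fires N M t M'"
    using assms unfolding increasing_def by auto
  then show ?thesis
    using firing_seq_snoc[of N M0 \<rho> M t M'] by auto
qed

text \<open>Covers the run in which the forward slice stops at once. Only transitions of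
  \<open>Tb\<close> feed \<open>Pb\<close>, so until one of them fires the tokens on
  \<open>Pb\<close> can only decrease, and none of them becomes enabled.\<close>

lemma no_firing_of_closed_set:
  assumes "firing_seq N M \<rho> M'"
    and "\<forall>p\<in>Pb. pre N p \<subseteq> Tb" and "\<forall>t\<in>Tb. pre N t \<subseteq> Pb"
    and "\<forall>t\<in>Tb. \<not> enabled N M t"
  shows "set \<rho> \<inter> Tb = {}"
  using assms(1,4)
proof (induction rule: firing_seq.induct)
  case (Cons M t M' \<rho> M'')
  have t: "t \<notin> Tb"
    using Cons by (auto simp: fires_def)
  have "M' p \<le> M p" if "p \<in> Pb" for p
  proof -
    have "flow N t p = 0"
      using that t assms(2) by (auto simp: pre_def)
    then show ?thesis
      using Cons(1) by (simp add: fires_def)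
  qed
  then have "enabled N M u" if "u \<in> Tb" "enabled N M' u" for u
    using that assms(3) unfolding enabled_def by (meson order_trans subsetD)
  then have "\<forall>u\<in>Tb. \<not> enabled N M' u"
    using Cons.prems by blast
  with Cons.IH t show ?case
    by simp
qed simp

text \<open>The invariant is that every marked place of \<open>Pb\<close> lies in \<open>Pf\<close>.
  An enabled transition of \<open>Tb\<close> has only marked input places, hence is in
  \<open>Tf\<close>; a token newly put on \<open>Pb\<close> comes from such a transition, whose
  postset is within \<open>Pf\<close>.\<close>

lemma firing_of_closed_set:
  assumes "firing_seq N M \<rho> M'"
    and "\<forall>p\<in>Pb. pre N p \<subseteq> Tb" and "\<forall>t\<in>Tb. pre N t \<subseteq> Pb"
    and "\<forall>t\<in>Tb. pre N t \<subseteq> Pf \<longrightarrow> t \<in> Tf" and "post_set N Tf \<subseteq> Pf"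
    and "\<forall>p\<in>Pb. 0 < M p \<longrightarrow> p \<in> Pf"
  shows "set \<rho> \<inter> Tb \<subseteq> Tf"
  using assms(1,6)
proof (induction rule: firing_seq.induct)
  case (Cons M t M' \<rho> M'')
  have "t \<in> Tf" if "t \<in> Tb"
  proof -
    have "enabled N M t"
      using Cons(1) by (simp add: fires_def)
    then have "0 < M p" if "p \<in> pre N t" for p
      using that by (rule enabled_imp_marked)
    then have "pre N t \<subseteq> Pf"
      using Cons.prems \<open>t \<in> Tb\<close> assms(3) by (meson subsetD subsetI)
    then show ?thesis
      using \<open>t \<in> Tb\<close> assms(4) by blast
  qed
  moreover have "p \<in> Pf" if "p \<in> Pb" "0 < M' p" for p
  proof (cases "flow N t p = 0")
    case True
    then have "0 < M p"
      using Cons(1) that(2) by (simp add: fires_def)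
    then show ?thesis
      using Cons.prems that(1) by blast
  next
    case False
    then have "t \<in> Tf"
      using \<open>t \<in> Tb \<Longrightarrow> t \<in> Tf\<close> that(1) assms(2) by (auto simp: pre_def)
    then show ?thesis
      using False assms(5) by (auto simp: post_set_def post_def)
  qed
  ultimately show ?case
    using Cons.IH by auto
qed simp

lemma enabled_restrict_net:
  assumes "enabled N M t" and "t \<in> T'" and "\<forall>p\<in>pre N t. p \<in> P'" and "\<forall>p\<in>P'. M p \<le> m p"
  shows "enabled (restrict_net N P' T') m t"
  unfolding enabled_def
proof (intro conjI ballI)
  fix p
  assume "p \<in> pre (restrict_net N P' T') t"
  then have "p \<in> pre N t"
    by (auto simp: pre_def restrict_net_def restrict_flow_def split: if_splits)
  then have "flow N p t \<le> M p" "M p \<le> m p"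
    using assms unfolding enabled_def by blast+
  then show "flow (restrict_net N P' T') p t \<le> m p"
    by (simp add: restrict_net_def restrict_flow_def)
qed (use assms(2) in \<open>simp add: restrict_net_def\<close>)

text \<open>The markings are compared by \<le> and not by equality because a dropped firing may
  consume tokens from \<open>P'\<close>. The third hypothesis says that it never produces any
  there.\<close>

lemma firing_seq_restrict_net:
  assumes "firing_seq N M \<rho> M'"
    and "\<forall>t\<in>T'. \<forall>p\<in>pre N t. p \<in> P'"
    and "\<forall>t\<in>set \<rho>. \<forall>p\<in>P'. flow N t p \<noteq> 0 \<longrightarrow> t \<in> T'"
    and "\<forall>p\<in>P'. M p \<le> m p"
  shows "\<exists>m'. firing_seq (restrict_net N P' T') m (filter (\<lambda>t. t \<in> T') \<rho>) m' \<and>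
    (\<forall>p\<in>P'. M' p \<le> m' p)"
  using assms(1,3,4)
proof (induction arbitrary: m rule: firing_seq.induct)
  case (Nil M)
  then show ?case
    by (auto intro: firing_seq.Nil)
next
  case (Cons M t M' \<rho> M'')
  let ?N = "restrict_net N P' T'"
  have M': "M' p = M p - flow N p t + flow N t p" for p
    using Cons(1) by (simp add: fires_def)
  show ?case
  proof (cases "t \<in> T'")
    case True
    define m1 where "m1 = (\<lambda>p. m p - flow ?N p t + flow ?N t p)"
    have "enabled ?N m t"
      using enabled_restrict_net[of N M t T' P' m] Cons.hyps(1) Cons.prems(2) True assms(2)
      by (auto simp: fires_def)
    then have "fires ?N m t m1"
      by (simp add: fires_def m1_def)
    \<comment> \<open>Between \<open>t\<close> and a place of \<open>P'\<close> both nets have the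
      same weights, and truncated subtraction is monotone.\<close>
    moreover have "\<forall>p\<in>P'. M' p \<le> m1 p"
      using Cons.prems(2) True
      by (auto simp: M' m1_def restrict_net_def restrict_flow_def intro!: diff_le_mono)
    ultimately show ?thesis
      using Cons.IH[of m1] Cons.prems(1) True by (auto intro: firing_seq.Cons)
  next
    case False
    then have "\<forall>p\<in>P'. M' p \<le> m p"
      using Cons.prems by (auto simp: M' intro: order_trans[OF diff_le_self])
    then show ?thesis
      using Cons.IH[of m] Cons.prems(1) False by auto
  qed
qed

text \<open>The bound between markings does not transfer a strict increase. The increase at
  \<open>p\<close> is therefore expressed by the weights of the arcs between \<open>p\<close> and
  the last transition, which do not depend on the marking.\<close>

lemma increasing_restrict_net:
  assumes "increasing N M0 Q \<sigma>"
    and "\<forall>t\<in>T'. \<forall>p\<in>pre N t. p \<in> P'"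
    and "\<forall>t\<in>set \<sigma>. \<forall>p\<in>P'. flow N t p \<noteq> 0 \<longrightarrow> t \<in> T'"
    and "\<forall>t\<in>set \<sigma>. \<forall>p\<in>Q. flow N t p \<noteq> 0 \<longrightarrow> p \<in> P'"
  shows "increasing_in_subnet (restrict_net N P' T') M0 Q (filter (\<lambda>t. t \<in> T') \<sigma>)"
proof -
  let ?N = "restrict_net N P' T'"
  obtain \<rho> t M M' p where \<sigma>: "\<sigma> = \<rho> @ [t]" and \<rho>: "firing_seq N M0 \<rho> M"
    and t: "fires N M t M'" and p: "p \<in> Q" "M p < M' p"
    using assms(1) unfolding increasing_def by blast
  have enb: "enabled N M t"
    using t by (simp add: fires_def)
  \<comment> \<open>Enabledness bounds the weight only on the preset of \<open>t\<close>; elsewhere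
    the weight is 0.\<close>
  have "flow N p t \<le> M p"
    using enb by (cases "p \<in> pre N t") (auto simp: enabled_def pre_def)
  with p(2) t have less: "flow N p t < flow N t p"
    by (simp add: fires_def)
  then have "p \<in> P'" "t \<in> T'"
    using assms(3,4) p(1) \<sigma> by auto
  have "\<exists>m. firing_seq ?N (restrict_marking M0 P') (filter (\<lambda>t. t \<in> T') \<rho>) m \<and>
      (\<forall>p\<in>P'. M p \<le> m p)"
    using \<rho> assms(2,3) \<sigma> by (intro firing_seq_restrict_net) (auto simp: restrict_marking_def)
  then obtain m where m: "firing_seq ?N (restrict_marking M0 P') (filter (\<lambda>t. t \<in> T') \<rho>) m"
    "\<forall>p\<in>P'. M p \<le> m p"
    by blast
  define m' where "m' = (\<lambda>p. m p - flow ?N p t + flow ?N t p)"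
  have "fires ?N m t m'"
    using enabled_restrict_net[OF enb \<open>t \<in> T'\<close> _ m(2)] assms(2) \<open>t \<in> T'\<close>
    by (simp add: fires_def m'_def)
  moreover have "m p < m' p"
    using less \<open>p \<in> P'\<close> \<open>t \<in> T'\<close> by (simp add: m'_def restrict_net_def restrict_flow_def)
  moreover have "p \<in> Q \<inter> places ?N"
    using \<open>p \<in> P'\<close> p(1) by (simp add: restrict_net_def)
  moreover have "filter (\<lambda>t. t \<in> T') \<sigma> = filter (\<lambda>t. t \<in> T') \<rho> @ [t]"
    using \<sigma> \<open>t \<in> T'\<close> by simp
  moreover have "places ?N = P'"
    by (simp add: restrict_net_def)
  ultimately show ?thesis
    unfolding increasing_in_subnet_def increasing_def using m(1) by metis
qed

section \<open>The result of the algorithm\<close>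

lemma reaches_target: "q \<in> Q \<Longrightarrow> reaches N Q q"
  unfolding reaches_def by blast

lemma reaches_step: "flow N x y \<noteq> 0 \<Longrightarrow> reaches N Q y \<Longrightarrow> reaches N Q x"
  unfolding reaches_def by (blast intro: converse_rtrancl_into_rtrancl)

lemma reaches_cases:
  assumes "reaches N Q x"
  obtains "x \<in> Q" | y where "flow N x y \<noteq> 0"
  using assms unfolding reaches_def by (blast elim: converse_rtranclE)

lemma subnet_restrict_net:
  assumes "petri_net N" and "P' \<subseteq> places N" and "T' \<subseteq> transitions N" and "P' \<union> T' \<noteq> {}"
  shows "subnet (restrict_net N P' T') N"
  using assms unfolding subnet_def petri_net_def
  by (auto simp: restrict_net_def restrict_flow_def intro: finite_subset split: if_splits)

lemma MaxSlice_exists: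
  assumes "petri_net N" and "slicing_criterion N M0 Q"
  shows "\<exists>res. MaxSlice N M0 Q res"
proof -
  have Q: "Q \<subseteq> places N"
    using assms(2) by (simp add: slicing_criterion_def)
  then obtain Pb Tb where b: "b_slice N Q {} (Pb, Tb)"
    using b_slice_exists[OF assms(1), of Q "{}"] by blast
  then have "finite Tb"
    using b_slice_subset[OF b assms(1) Q] assms(1) by (auto simp: petri_net_def intro: finite_subset)
  then obtain Pf Tf where
    "f_slice N Tb {p \<in> Pb. M0 p > 0} {} {t \<in> Tb. enabled N M0 t} (Pf, Tf)"
    using f_slice_exists[of Tb "{t \<in> Tb. enabled N M0 t}" "{}" N "{p \<in> Pb. M0 p > 0}"] by blast
  with b show ?thesis
    unfolding MaxSlice_def by blast
qed

text \<open>\<open>res\<close> is an arbitrary outcome, whatever places were chosen in the backward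
  slice: the argument uses only inclusion and closure properties of the computed sets. The sequence
  \<sigma>0 excludes the answer \<open>None\<close>.\<close>

lemma MaxSlice_maximal_slice:
  assumes N: "petri_net N" and crit: "slicing_criterion N M0 Q"
    and incr: "increasing N M0 Q \<sigma>0" and res: "MaxSlice N M0 Q res"
  shows "\<exists>N'. res = Some N' \<and> maximal_slice N' N M0 Q"
proof -
  obtain Pb Tb Pf Tf Nf where b: "b_slice N Q {} (Pb, Tb)"
    and f: "f_slice N Tb {p \<in> Pb. M0 p > 0} {} {t \<in> Tb. enabled N M0 t} (Pf, Tf)"
    and Nf: "Nf = restrict_net (restrict_net N Pb Tb) Pf Tf"
    and res: "res = (if Nf = empty_net then None
      else Some (restrict_net N {p \<in> Pf. reaches Nf Q p} {t \<in> Tf. reaches Nf Q t}))"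
    using res unfolding MaxSlice_def by blast
  let ?P = "{p \<in> Pf. reaches Nf Q p}" and ?T = "{t \<in> Tf. reaches Nf Q t}"
  let ?N = "restrict_net N ?P ?T"

  have Q: "Q \<subseteq> places N"
    using crit by (simp add: slicing_criterion_def)
  have "Q \<subseteq> Pb" and pre_Pb: "\<forall>p\<in>Pb. pre N p \<subseteq> Tb" and pre_Tb: "\<forall>t\<in>Tb. pre N t \<subseteq> Pb"
    using b_slice_closed[OF b] by auto
  have Pb: "Pb \<subseteq> places N" and Tb: "Tb \<subseteq> transitions N"
    using b_slice_subset[OF b N Q] by auto
  have Tf: "Tf \<subseteq> Tb"
    using f_slice_transitions[OF f] by blast
  have Pf_eq: "Pf = {p \<in> Pb. M0 p > 0} \<union> post_set N Tf"
    using f_slice_places[OF f] by (auto simp: post_set_def)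
  have Pf: "Pf \<subseteq> places N"
    using Pf_eq Pb Tf Tb petri_net_arcs(3)[OF N] unfolding post_set_def by blast
  have pre_Tf: "\<forall>t\<in>Tf. pre N t \<subseteq> Pf"
    using f_slice_pre[OF f] enabled_imp_marked[of N M0] pre_Tb by blast
  \<comment> \<open>\<open>Pf\<close> may leave \<open>Pb\<close>, and the arcs at places outside
    \<open>Pb\<close> are already cut in the backward slice; hence the intersection.\<close>
  have flow_Nf: "flow Nf x y = flow N x y"
    if "x \<in> Pb \<inter> Pf \<and> y \<in> Tf \<or> x \<in> Tf \<and> y \<in> Pb \<inter> Pf" for x y
    using that Tf by (auto simp: Nf restrict_net_def restrict_flow_def)

  \<comment> \<open>With arc weights above 1, all input places of a transition may be marked without
    enabling it. If nothing in \<open>Tb\<close> is enabled at the start, closure of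
    \<open>Tf\<close> can thus fail, but then no transition of \<open>Tb\<close> ever fires.\<close>
  have Tb_fired: "set \<sigma> \<inter> Tb \<subseteq> Tf" if "firing_seq N M0 \<sigma> M" for \<sigma> M
  proof (cases "{t \<in> Tb. enabled N M0 t} = {}")
    case True
    then show ?thesis
      using no_firing_of_closed_set[OF that pre_Pb pre_Tb] by blast
  next
    case False
    then show ?thesis
      using firing_of_closed_set[OF that pre_Pb pre_Tb, of Pf Tf] f_slice_closed[OF f] Pf_eq
      by blast
  qed

  \<comment> \<open>A fired transition feeding \<open>p\<close> is in \<open>Tb\<close> by backward
    closure, hence in \<open>Tf\<close>. So the arc survives in \<open>Nf\<close>, and
    \<open>t\<close> inherits the path from \<open>p\<close> to \<open>Q\<close>.\<close>
  have arc: "t \<in> ?T \<and> p \<in> ?P"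
    if "p \<in> Pb" "flow N t p \<noteq> 0" "firing_seq N M0 \<sigma> M" "t \<in> set \<sigma>" "reaches Nf Q p" for t p \<sigma> M
  proof -
    have "t \<in> Tf"
      using that Tb_fired pre_Pb by (fastforce simp: pre_def)
    moreover from this have "p \<in> Pf"
      using that(2) Pf_eq by (auto simp: post_set_def post_def)
    moreover from calculation have "reaches Nf Q t"
      using that(1,2,5) reaches_step[of Nf t p Q] flow_Nf[of t p] by simp
    ultimately show ?thesis
      using that(5) by blast
  qed

  \<comment> \<open>The path condition removes the places of \<open>Pf\<close> outside
    \<open>Pb\<close>: they are not in \<open>Q\<close> and have no outgoing arc in
    \<open>Nf\<close>.\<close>
  have P_Pb: "?P \<subseteq> Pb"
  proof
    fix p
    assume p: "p \<in> ?P"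
    then have "reaches Nf Q p"
      by blast
    then show "p \<in> Pb"
    proof (cases rule: reaches_cases)
      case 1
      then show ?thesis
        using \<open>Q \<subseteq> Pb\<close> by blast
    next
      case (2 y)
      moreover have "p \<notin> Tb"
        using p Pf Tb N by (auto simp: petri_net_def)
      ultimately show ?thesis
        by (auto simp: Nf restrict_net_def restrict_flow_def split: if_splits)
    qed
  qed

  have pre_T: "\<forall>t\<in>?T. \<forall>p\<in>pre N t. p \<in> ?P"
  proof (intro ballI)
    fix t p
    assume t: "t \<in> ?T" and p: "p \<in> pre N t"
    then have "p \<in> Pb \<inter> Pf"
      using pre_Tf pre_Tb Tf by blast
    then show "p \<in> ?P"
      using t p reaches_step[of Nf p t Q] flow_Nf[of p t] by (simp add: pre_def)
  qed

  have sim: "increasing_in_subnet ?N M0 Q (filter (\<lambda>t. t \<in> ?T) \<sigma>)"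
    if "increasing N M0 Q \<sigma>" for \<sigma>
  proof -
    obtain M where \<sigma>: "firing_seq N M0 \<sigma> M"
      using increasing_firing_seq[OF \<open>increasing N M0 Q \<sigma>\<close>] by blast
    show ?thesis
    proof (rule increasing_restrict_net[OF that pre_T]; intro ballI impI)
      fix t p
      assume "t \<in> set \<sigma>" "p \<in> ?P" "flow N t p \<noteq> 0"
      moreover from this have "p \<in> Pb" "reaches Nf Q p"
        using P_Pb by auto
      ultimately show "t \<in> ?T"
        using arc \<sigma> by blast
    next
      fix t p
      assume "t \<in> set \<sigma>" "p \<in> Q" "flow N t p \<noteq> 0"
      moreover from this have "p \<in> Pb" "reaches Nf Q p"
        using \<open>Q \<subseteq> Pb\<close> reaches_target[of p Q Nf] by auto
      ultimately show "p \<in> ?P"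
        using arc \<sigma> by blast
    qed
  qed

  \<comment> \<open>An increasing sequence has a last transition, so the filtered list is nonempty.
    This excludes the empty net, both as \<open>Nf\<close> and as the result, where it would not be
    a Petri net.\<close>
  have "?T \<noteq> {}"
  proof
    assume "?T = {}"
    then show False
      using sim[OF incr] by (simp add: increasing_in_subnet_def increasing_def)
  qed
  then have "Nf \<noteq> empty_net"
    by (auto simp: Nf restrict_net_def empty_net_def)
  moreover have "subnet ?N N"
    using \<open>?T \<noteq> {}\<close> Pf Tf Tb by (intro subnet_restrict_net[OF N]) auto
  then have "maximal_slice ?N N M0 Q"
    using sim incr pre_T unfolding maximal_slice_def slice_def subsequence_wrt_def
    by (auto simp: restrict_net_def)
  ultimately show ?thesis
    using res by simp
qed

theorem theorem3p4:
  fixes N :: "'a net" and M0 :: "'a marking" and Q :: "'a set"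
  assumes "petri_net N"
    and "slicing_criterion N M0 Q"
    and "\<exists>S. slice S N M0 Q"
  shows "(\<exists>N'. MaxSlice N M0 Q (Some N')) \<and>
         (\<forall>res. MaxSlice N M0 Q res \<longrightarrow> (\<exists>N'. res = Some N' \<and> maximal_slice N' N M0 Q))"
proof -
  obtain \<sigma> where "increasing N M0 Q \<sigma>"
    using assms(3) unfolding slice_def by blast
  then show ?thesis
    using MaxSlice_maximal_slice[OF assms(1,2)] MaxSlice_exists[OF assms(1,2)] by blast
qed

end
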